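(* For every integer $n\ge1$ let a controlled Schrödinger equation on $\mathcal H_n=(\mathbb C^2)^{\otimes n}$ be given, $$ i\frac{d}{dt}\psi(t)=\Big(H_0+\sum_{j=1}^{m}u_j(t)H_j\Big)\psi(t), $$ with self-adjoint operators $H_0,H_1,\dots,H_m$ on $\mathcal H_n$ (and $m$) depending on $n$, and controls bounded by $M>0$. Assume that: (a) for every $n$ the equation is operator controllable; (b) the equation has uniformly bounded elementary gate time: there is a constant $\tau>0$, independent of $n$, such that $T_{\min}(G)\le\tau$ for every elementary gate $G$ acting nontrivially on at most $2$ qubits. Then the Quantum Fourier Transform $\Gamma_{\mathrm{QFT}}$ exhibits Quantum Advantage: for every $n$ there exist a time horizon and admissible controls steering $I$ to $\Gamma_{\mathrm{QFT}}$, and there exist a constant $C$ and an integer $p$, both independent of $n$, with $T_{\min}(\Gamma_{\mathrm{QFT}})\le Cn^p$. Specifically, for every $n\geq 1$, $$ T_{\min}(\Gamma_{\mathrm{QFT}})\le\tau\Big(\frac{n(n+1)}2+\Big\lfloor\frac n2\Big\rfloor\Big)\le\tau n^2. $$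
   Context: Write $N=2^n$. For controls $u=(u_j)_{j=1}^m$ with $u_j$ measurable and $|u_j(t)|\le M$ a.e., let $U$ be the solution of $i\,U'(t)=(H_0+\sum_{j=1}^m u_j(t)H_j)U(t)$, $U(0)=I$ ($N\times N$ matrices). Operator controllability: for every unitary operator $\Gamma:\mathcal H_n\to\mathcal H_n$ there exist $T>0$ and controls $u_j:[0,T]\to[-M,M]$ such that $U(T)=\Gamma$. Minimal time of a unitary target $\Gamma$: $T_{\min}(\Gamma)=\inf\{T>0 : \text{there exist controls } u_j:[0,T]\to[-M,M]\text{ with }U(T)=\Gamma\}$. An elementary gate acting nontrivially on at most 2 qubits is a unitary operator on $(\mathbb C^2)^{\otimes n}$ that acts as the identity on all tensor factors except at most two. Quantum Fourier Transform on $n$ qubits: the unitary operator with $\Gamma_{\mathrm{QFT}}|k\rangle=\frac1{\sqrt{2^n}}\sum_{l=0}^{2^n-1}e^{2\pi i kl/2^n}|l\rangle$ for $k\in\{0,\dots,2^n-1\}$, where the computational basis vector $|k\rangle=|k_1\rangle\otimes\cdots\otimes|k_n\rangle$ corresponds to the binary expansion $k=\sum_{j=1}^n k_j2^{n-j}$. Quantum Advantage (for a computational problem given by a family of unitary targets whose best known classical algorithm takes time exponential in $n$, as is the case for the Fourier transform on $2^n$ points) means: the set of controls steering $I$ to the target is nonempty, and $T_{\min}\le Cn^p$ with $C,p$ independent of $n$. *)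

theory Defs
  imports "HOL-Analysis.Analysis" "Jordan_Normal_Form.Schur_Decomposition"
begin

text \<open>
  The space of \<open>n\<close> qubits, the \<open>n\<close>-fold tensor power of \<open>\<complex>\<^sup>2\<close>, is coordinatised by its computational
  basis, ordered by binary expansion: operators are complex matrices of size \<open>2 ^ n\<close> with rows and
  columns indexed from 0.
\<close>

definition self_adjoint_op :: "nat \<Rightarrow> complex mat \<Rightarrow> bool" where
  "self_adjoint_op N A \<longleftrightarrow> A \<in> carrier_mat N N \<and> mat_adjoint A = A"

definition unitary_op :: "nat \<Rightarrow> complex mat \<Rightarrow> bool" where
  "unitary_op N A \<longleftrightarrow> A \<in> carrier_mat N N
     \<and> mat_adjoint A * A = 1\<^sub>m N \<and> A * mat_adjoint A = 1\<^sub>m N"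

text \<open>
  The usual epsilon-delta notion for functions; the constant \<^const>\<open>absolutely_continuous\<close> of the
  library concerns measures. Degenerate intervals are allowed, since they contribute nothing.
\<close>

definition abs_continuous_on :: "real set \<Rightarrow> (real \<Rightarrow> 'a :: metric_space) \<Rightarrow> bool" where
  "abs_continuous_on S f \<longleftrightarrow>
     (\<forall>\<epsilon>>0. \<exists>\<delta>>0. \<forall>(K :: nat) a b.
        (\<forall>k<K. a k \<le> b k \<and> {a k..b k} \<subseteq> S)
        \<and> (\<forall>k<K. \<forall>l<K. k \<noteq> l \<longrightarrow> {a k<..<b k} \<inter> {a l<..<b l} = {})
        \<and> (\<Sum>k<K. b k - a k) < \<delta>
        \<longrightarrow> (\<Sum>k<K. dist (f (a k)) (f (b k))) < \<epsilon>)"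

text \<open>
  In the control system below, \<open>H 0\<close> is the drift and \<open>H 1, \<dots>, H m\<close> are the control Hamiltonians;
  \<open>u j\<close> is the control multiplying \<open>H j\<close>.
\<close>

definition hamiltonian ::
  "nat \<Rightarrow> nat \<Rightarrow> (nat \<Rightarrow> complex mat) \<Rightarrow> (nat \<Rightarrow> real \<Rightarrow> real) \<Rightarrow> real \<Rightarrow> complex mat" where
  "hamiltonian N m H u t =
     mat N N (\<lambda>rc. H 0 $$ rc + (\<Sum>j=1..m. complex_of_real (u j t) * H j $$ rc))"

definition admissible_control :: "nat \<Rightarrow> real \<Rightarrow> real \<Rightarrow> (nat \<Rightarrow> real \<Rightarrow> real) \<Rightarrow> bool" where
  "admissible_control m M T u \<longleftrightarrow>
     (\<forall>j\<in>{1..m}. u j \<in> borel_measurable (lebesgue_on {0..T})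
        \<and> (AE t in lebesgue_on {0..T}. \<bar>u j t\<bar> \<le> M))"

text \<open>
  As the controls are merely measurable, the initial value problem
  \<open>\<i> U'(t) = (H\<^sub>0 + \<Sum>\<^sub>j u\<^sub>j(t) H\<^sub>j) U(t)\<close>, \<open>U(0) = I\<close> is understood in the sense of Caratheodory:
  \<open>U\<close> is absolutely continuous and satisfies the equation almost everywhere. In
  \<open>is_propagator\<close>, \<open>V\<close> is the derivative of \<open>U\<close> at \<open>t\<close>, taken entrywise.
\<close>

definition is_propagator ::
  "nat \<Rightarrow> nat \<Rightarrow> (nat \<Rightarrow> complex mat) \<Rightarrow> (nat \<Rightarrow> real \<Rightarrow> real) \<Rightarrow> real \<Rightarrow> (real \<Rightarrow> complex mat) \<Rightarrow> bool"
where
  "is_propagator N m H u T U \<longleftrightarrow>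
     (\<forall>t\<in>{0..T}. U t \<in> carrier_mat N N)
     \<and> U 0 = 1\<^sub>m N
     \<and> (\<forall>r<N. \<forall>c<N. abs_continuous_on {0..T} (\<lambda>t. U t $$ (r, c)))
     \<and> (AE t in lebesgue_on {0..T}. \<exists>V \<in> carrier_mat N N.
          (\<forall>r<N. \<forall>c<N.
             ((\<lambda>s. U s $$ (r, c)) has_vector_derivative V $$ (r, c)) (at t within {0..T}))
          \<and> \<i> \<cdot>\<^sub>m V = hamiltonian N m H u t * U t)"

definition steers ::
  "nat \<Rightarrow> nat \<Rightarrow> (nat \<Rightarrow> complex mat) \<Rightarrow> real \<Rightarrow> real \<Rightarrow> (nat \<Rightarrow> real \<Rightarrow> real) \<Rightarrow> complex mat \<Rightarrow> bool"
where
  "steers N m H M T u \<Gamma> \<longleftrightarrow>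
     admissible_control m M T u \<and> (\<exists>U. is_propagator N m H u T U \<and> U T = \<Gamma>)"

definition operator_controllable :: "nat \<Rightarrow> nat \<Rightarrow> (nat \<Rightarrow> complex mat) \<Rightarrow> real \<Rightarrow> bool" where
  "operator_controllable N m H M \<longleftrightarrow>
     (\<forall>\<Gamma>. unitary_op N \<Gamma> \<longrightarrow> (\<exists>T>0. \<exists>u. steers N m H M T u \<Gamma>))"

text \<open>Extended real values are used so that the infimum over the empty set is \<open>\<infinity>\<close>.\<close>

definition min_time :: "nat \<Rightarrow> nat \<Rightarrow> (nat \<Rightarrow> complex mat) \<Rightarrow> real \<Rightarrow> complex mat \<Rightarrow> ereal" where
  "min_time N m H M \<Gamma> = Inf {ereal T | T. T > 0 \<and> (\<exists>u. steers N m H M T u \<Gamma>)}"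

text \<open>
  \<open>qubit_value n k j\<close> is the binary digit \<open>k\<^sub>j\<close> in \<open>k = (\<Sum>j=1..n. k\<^sub>j * 2 ^ (n - j))\<close>, that is, the
  state of the \<open>j\<close>-th tensor factor in the \<open>k\<close>-th computational basis vector.
\<close>

definition qubit_value :: "nat \<Rightarrow> nat \<Rightarrow> nat \<Rightarrow> nat" where
  "qubit_value n k j = k div 2 ^ (n - j) mod 2"

text \<open>
  \<open>G\<close> acts as the identity on the tensor factors outside \<open>S\<close> if it is the tensor product of an
  operator \<open>A\<close> on the factors in \<open>S\<close> with the identity on the remaining ones. Here \<open>A\<close> is given by
  its matrix entries, indexed by the computational basis states of the factors in \<open>S\<close>; the matrix
  entries of the identity on the remaining factors are products of Kronecker deltas.
\<close>

definition acts_only_on :: "nat \<Rightarrow> nat set \<Rightarrow> complex mat \<Rightarrow> bool" where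
  "acts_only_on n S G \<longleftrightarrow>
     G \<in> carrier_mat (2 ^ n) (2 ^ n)
     \<and> (\<exists>A :: (nat \<Rightarrow> nat) \<Rightarrow> (nat \<Rightarrow> nat) \<Rightarrow> complex. \<forall>k<2 ^ n. \<forall>l<2 ^ n.
          G $$ (k, l) =
            A (restrict (qubit_value n k) S) (restrict (qubit_value n l) S)
            * (\<Prod>j\<in>{1..n} - S. if qubit_value n k j = qubit_value n l j then 1 else 0))"

definition elementary_gate :: "nat \<Rightarrow> complex mat \<Rightarrow> bool" where
  "elementary_gate n G \<longleftrightarrow>
     unitary_op (2 ^ n) G \<and> (\<exists>S\<subseteq>{1..n}. card S \<le> 2 \<and> acts_only_on n S G)"

text \<open>Column \<open>k\<close> of the matrix is the image of the \<open>k\<close>-th computational basis vector.\<close>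

definition qft :: "nat \<Rightarrow> complex mat" where
  "qft n = mat (2 ^ n) (2 ^ n)
     (\<lambda>(l, k). exp (2 * complex_of_real pi * \<i> * of_nat k * of_nat l / 2 ^ n)
               / complex_of_real (sqrt (2 ^ n)))"

text \<open>
  The side condition that no efficient classical algorithm for the computational problem is known
  is a convention on which families of targets the notion is applied to, not a mathematical clause.
\<close>

definition quantum_advantage ::
  "(nat \<Rightarrow> nat) \<Rightarrow> (nat \<Rightarrow> nat \<Rightarrow> complex mat) \<Rightarrow> real \<Rightarrow> (nat \<Rightarrow> complex mat) \<Rightarrow> bool" where
  "quantum_advantage m H M \<Gamma> \<longleftrightarrow>
     (\<forall>n\<ge>1. \<exists>T>0. \<exists>u. steers (2 ^ n) (m n) (H n) M T u (\<Gamma> n))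
     \<and> (\<exists>(C :: real) (p :: nat). \<forall>n\<ge>1.
          min_time (2 ^ n) (m n) (H n) M (\<Gamma> n) \<le> ereal (C * real n ^ p))"

end

theory Submission
  imports Defs
begin

text \<open>
  Running a control for \<open>A\<close> and then one for \<open>B\<close> steers the identity to \<open>B * A\<close>, so the minimal time
  is subadditive on products, and a product of \<open>k\<close> elementary gates is reached in time at most \<open>k \<tau>\<close>.
  The standard circuit writes the Fourier transform as such a product: each qubit gets a Hadamard
  gate followed by phases controlled by the less significant qubits, which makes \<open>n (n + 1) / 2\<close> gates,
  and \<open>\<lfloor>n / 2\<rfloor>\<close> swaps then reverse the order of the qubits.
\<close>

subsection \<open>Absolutely continuous functions\<close>

text \<open>Two controls can be run in succession because the operators \<open>H j\<close> do not
  depend on time: from \<open>T1\<close> on, the solution is a time-shifted solution times the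
  constant matrix reached at \<open>T1\<close>. Since the equation holds only almost everywhere, the
  glued curve must also be shown absolutely continuous across the joint, where the control may jump.
  The infimum in the minimal time need not be attained, so durations are compared up to \<epsilon>.
  The circuit is verified without expanding a product of gates: each partial product has a closed
  form, in which row \<open>x\<close> and column \<open>k\<close> must agree in the untreated digits
  and otherwise only a phase proportional to \<open>k\<close> remains. The treated digit of
  \<open>x\<close> at position \<open>q\<close> contributes \<open>k / 2 ^ Suc q\<close> turns.
  Whole turns vanish, so only the digits of \<open>k\<close> up to \<open>q\<close> matter: digit
  \<open>q\<close> gives the Hadamard sign and each of the \<open>q\<close> lower digits one
  controlled phase. That is \<open>q + 1\<close> gates for position \<open>q\<close>, and the sum
  over \<open>q < n\<close> is \<open>n (n + 1) / 2\<close>.\<close>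

lemma AE_lebesgue_on_Icc_iff_negligible:
  fixes a b :: real
  shows "(AE t in lebesgue_on {a..b}. P t) \<longleftrightarrow> negligible {t \<in> {a..b}. \<not> P t}"
proof -
  have "(AE t in lebesgue_on {a..b}. P t) \<longleftrightarrow> (AE t in lebesgue. t \<in> {a..b} \<longrightarrow> P t)"
    by (subst AE_restrict_space_iff) auto
  also have "\<dots> \<longleftrightarrow> (\<exists>N. negligible N \<and> {t \<in> {a..b}. \<not> P t} \<subseteq> N)"
    by (simp add: eventually_ae_filter negligible_iff_null_sets Bex_def)
  \<comment> \<open>Lebesgue measure is complete, so the exceptional set itself can serve as the
    null set \<open>N\<close>.\<close>
  also have "\<dots> \<longleftrightarrow> negligible {t \<in> {a..b}. \<not> P t}"
    using negligible_subset by blast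
  finally show ?thesis .
qed

text \<open>The condition on interval families in \<open>abs_continuous_on\<close>, named so that
  such families can be shifted and cut. Degenerate intervals allow cutting without
  reindexing.\<close>

definition nonoverlapping :: "real set \<Rightarrow> nat \<Rightarrow> (nat \<Rightarrow> real) \<Rightarrow> (nat \<Rightarrow> real) \<Rightarrow> bool" where
  "nonoverlapping S K a b \<longleftrightarrow>
     (\<forall>k<K. a k \<le> b k \<and> {a k..b k} \<subseteq> S)
     \<and> (\<forall>k<K. \<forall>l<K. k \<noteq> l \<longrightarrow> {a k<..<b k} \<inter> {a l<..<b l} = {})"

lemma abs_continuous_on_iff:
  "abs_continuous_on S f \<longleftrightarrow>
     (\<forall>\<epsilon>>0. \<exists>\<delta>>0. \<forall>K a b. nonoverlapping S K a b \<longrightarrow> (\<Sum>k<K. b k - a k) < \<delta> \<longrightarrow>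
        (\<Sum>k<K. dist (f (a k)) (f (b k))) < \<epsilon>)"
  unfolding abs_continuous_on_def nonoverlapping_def by (simp only: conj_assoc imp_conjL)

text \<open>Finitely many tolerances have a common positive \<delta>, so a bound on increments
  passes absolute continuity on to \<open>g\<close>. It serves both for changing a function off
  \<open>S\<close> and for linear combinations of matrix entries.\<close>

lemma abs_continuous_on_dominated:
  fixes f :: "'i \<Rightarrow> real \<Rightarrow> 'a :: metric_space"
  assumes "finite I" and f: "\<And>i. i \<in> I \<Longrightarrow> abs_continuous_on S (f i)"
    and g: "\<And>x y. \<lbrakk>x \<in> S; y \<in> S\<rbrakk> \<Longrightarrow> dist (g x) (g y) \<le> C * (\<Sum>i\<in>I. dist (f i x) (f i y))"
  shows "abs_continuous_on S g"
  unfolding abs_continuous_on_iff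
proof (intro allI impI)
  fix \<epsilon> :: real assume "\<epsilon> > 0"
  \<comment> \<open>The added ones keep the denominator positive when \<open>C = 0\<close> or
    \<open>I\<close> is empty, and make the final estimate strict.\<close>
  define e where "e = \<epsilon> / ((\<bar>C\<bar> + 1) * (real (card I) + 1))"
  have "e > 0" using \<open>\<epsilon> > 0\<close> by (simp add: e_def)
  have "\<forall>i\<in>I. \<exists>\<delta>>0. \<forall>K a b. nonoverlapping S K a b \<longrightarrow> (\<Sum>k<K. b k - a k) < \<delta> \<longrightarrow>
        (\<Sum>k<K. dist (f i (a k)) (f i (b k))) < e"
    using f \<open>e > 0\<close> by (simp add: abs_continuous_on_iff)
  then obtain d where d: "\<forall>i\<in>I. d i > 0 \<and> (\<forall>K a b. nonoverlapping S K a b \<longrightarrow>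
        (\<Sum>k<K. b k - a k) < d i \<longrightarrow> (\<Sum>k<K. dist (f i (a k)) (f i (b k))) < e)"
    by (rule bchoice[THEN exE])
  define \<delta> where "\<delta> = Min (insert 1 (d ` I))"
  have "\<delta> > 0" using \<open>finite I\<close> d by (simp add: \<delta>_def)
  moreover have "(\<Sum>k<K. dist (g (a k)) (g (b k))) < \<epsilon>"
    if ab: "nonoverlapping S K a b" and len: "(\<Sum>k<K. b k - a k) < \<delta>" for K a b
  proof -
    have "(\<Sum>k<K. dist (f i (a k)) (f i (b k))) \<le> e" if "i \<in> I" for i
    proof -
      have "\<delta> \<le> d i" using \<open>finite I\<close> that by (simp add: \<delta>_def)
      then have "(\<Sum>k<K. b k - a k) < d i" using len by simp
      then show ?thesis using d that ab by (meson less_imp_le)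
    qed
    then have le: "(\<Sum>i\<in>I. \<Sum>k<K. dist (f i (a k)) (f i (b k))) \<le> real (card I) * e"
      by (rule sum_bounded_above)
    have "(\<Sum>k<K. dist (g (a k)) (g (b k))) \<le> (\<Sum>k<K. \<bar>C\<bar> * (\<Sum>i\<in>I. dist (f i (a k)) (f i (b k))))"
    proof (rule sum_mono)
      fix k assume "k \<in> {..<K}"
      with ab have "a k \<le> b k" "{a k..b k} \<subseteq> S" by (auto simp: nonoverlapping_def)
      then have "a k \<in> S" "b k \<in> S" by auto
      then have "dist (g (a k)) (g (b k)) \<le> C * (\<Sum>i\<in>I. dist (f i (a k)) (f i (b k)))" by (rule g)
      also have "\<dots> \<le> \<bar>C\<bar> * (\<Sum>i\<in>I. dist (f i (a k)) (f i (b k)))"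
        by (intro mult_right_mono sum_nonneg) auto
      finally show "dist (g (a k)) (g (b k)) \<le> \<dots>" .
    qed
    also have "\<dots> = \<bar>C\<bar> * (\<Sum>i\<in>I. \<Sum>k<K. dist (f i (a k)) (f i (b k)))"
      by (subst sum.swap) (simp add: sum_distrib_left)
    also have "\<dots> \<le> \<bar>C\<bar> * (real (card I) * e)"
      using le by (simp add: mult_left_mono)
    also have "\<dots> < (\<bar>C\<bar> + 1) * ((real (card I) + 1) * e)"
      by (rule mult_strict_mono') (use \<open>e > 0\<close> in \<open>auto simp: distrib_right\<close>)
    also have "\<dots> = \<epsilon>"
      unfolding e_def by (simp add: field_simps add_nonneg_eq_0_iff)
    finally show ?thesis .
  qed
  ultimately show "\<exists>\<delta>>0. \<forall>K a b. nonoverlapping S K a b \<longrightarrow> (\<Sum>k<K. b k - a k) < \<delta> \<longrightarrow>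
        (\<Sum>k<K. dist (g (a k)) (g (b k))) < \<epsilon>" by (intro exI[of _ \<delta>]) auto
qed

lemma abs_continuous_on_cong:
  assumes "abs_continuous_on S f" "\<And>x. x \<in> S \<Longrightarrow> f x = g x"
  shows "abs_continuous_on S g"
  by (rule abs_continuous_on_dominated[of "{()}" S "\<lambda>_. f" g 1]) (use assms in auto)

lemma abs_continuous_on_shift:
  assumes "abs_continuous_on {a..b} f"
  shows "abs_continuous_on {a + c..b + c} (\<lambda>t. f (t - c))"
  unfolding abs_continuous_on_iff
proof (intro allI impI)
  fix \<epsilon> :: real assume "\<epsilon> > 0"
  then obtain \<delta> where \<delta>: "\<delta> > 0" "\<forall>K x y. nonoverlapping {a..b} K x y \<longrightarrow>
      (\<Sum>k<K. y k - x k) < \<delta> \<longrightarrow> (\<Sum>k<K. dist (f (x k)) (f (y k))) < \<epsilon>"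
    using assms by (auto simp: abs_continuous_on_iff)
  have "nonoverlapping {a..b} K (\<lambda>k. x k - c) (\<lambda>k. y k - c)"
    if "nonoverlapping {a + c..b + c} K x y" for K x y
    using that by (force simp: nonoverlapping_def)
  with \<delta>(2) have "(\<Sum>k<K. dist (f (x k - c)) (f (y k - c))) < \<epsilon>"
    if "nonoverlapping {a + c..b + c} K x y" "(\<Sum>k<K. y k - x k) < \<delta>" for K x y
    using that by (elim allE[of _ K] allE[of _ "\<lambda>k. x k - c"] allE[of _ "\<lambda>k. y k - c"]) simp
  with \<delta>(1) show "\<exists>\<delta>>0. \<forall>K x y. nonoverlapping {a + c..b + c} K x y \<longrightarrow>
      (\<Sum>k<K. y k - x k) < \<delta> \<longrightarrow> (\<Sum>k<K. dist (f (x k - c)) (f (y k - c))) < \<epsilon>"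
    by (intro exI[of _ \<delta>]) auto
qed

text \<open>Every interval is clamped at \<open>c\<close>: \<open>min _ c\<close> keeps its left
  part and \<open>max _ c\<close> its right part. An interval on the wrong side collapses to a point
  and contributes zero, so both families keep the index set \<open>{..<K}\<close>, and each is given
  half of \<epsilon>.\<close>

lemma abs_continuous_on_combine:
  fixes f :: "real \<Rightarrow> 'a :: metric_space"
  assumes "abs_continuous_on {a..c} f" "abs_continuous_on {c..b} f" and abc: "a \<le> c" "c \<le> b"
  shows "abs_continuous_on {a..b} f"
  unfolding abs_continuous_on_iff
proof (intro allI impI)
  fix \<epsilon> :: real assume "\<epsilon> > 0"
  then have e: "\<epsilon> / 2 > 0" by simp
  obtain \<delta>1 where \<delta>1: "\<delta>1 > 0" "\<And>K x y. nonoverlapping {a..c} K x y \<Longrightarrow>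
      (\<Sum>k<K. y k - x k) < \<delta>1 \<Longrightarrow> (\<Sum>k<K. dist (f (x k)) (f (y k))) < \<epsilon> / 2"
    using assms(1) e unfolding abs_continuous_on_iff by metis
  obtain \<delta>2 where \<delta>2: "\<delta>2 > 0" "\<And>K x y. nonoverlapping {c..b} K x y \<Longrightarrow>
      (\<Sum>k<K. y k - x k) < \<delta>2 \<Longrightarrow> (\<Sum>k<K. dist (f (x k)) (f (y k))) < \<epsilon> / 2"
    using assms(2) e unfolding abs_continuous_on_iff by metis
  have "(\<Sum>k<K. dist (f (x k)) (f (y k))) < \<epsilon>"
    if xy: "nonoverlapping {a..b} K x y" and len: "(\<Sum>k<K. y k - x k) < min \<delta>1 \<delta>2" for K x y
  proof -
    have range: "a \<le> x k" "x k \<le> y k" "y k \<le> b" if "k < K" for k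
      using xy that by (auto simp: nonoverlapping_def)
    have disj: "{x k<..<y k} \<inter> {x l<..<y l} = {}" if "k < K" "l < K" "k \<noteq> l" for k l
      using xy that by (auto simp: nonoverlapping_def)
    have "(\<Sum>k<K. dist (f (min (x k) c)) (f (min (y k) c))) < \<epsilon> / 2"
    proof (rule \<delta>1)
      have "{min (x k) c<..<min (y k) c} \<subseteq> {x k<..<y k}" for k by auto
      then have "{min (x k) c<..<min (y k) c} \<inter> {min (x l) c<..<min (y l) c} = {}"
        if "k < K" "l < K" "k \<noteq> l" for k l using disj[OF that] by blast
      then show "nonoverlapping {a..c} K (\<lambda>k. min (x k) c) (\<lambda>k. min (y k) c)"
        using range abc unfolding nonoverlapping_def by (fastforce simp: min_le_iff_disj)
      have "(\<Sum>k<K. min (y k) c - min (x k) c) \<le> (\<Sum>k<K. y k - x k)"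
        by (rule sum_mono) (use range in \<open>force simp: min_def\<close>)
      then show "(\<Sum>k<K. min (y k) c - min (x k) c) < \<delta>1" using len by simp
    qed
    moreover have "(\<Sum>k<K. dist (f (max (x k) c)) (f (max (y k) c))) < \<epsilon> / 2"
    proof (rule \<delta>2)
      have "{max (x k) c<..<max (y k) c} \<subseteq> {x k<..<y k}" for k by auto
      then have "{max (x k) c<..<max (y k) c} \<inter> {max (x l) c<..<max (y l) c} = {}"
        if "k < K" "l < K" "k \<noteq> l" for k l using disj[OF that] by blast
      then show "nonoverlapping {c..b} K (\<lambda>k. max (x k) c) (\<lambda>k. max (y k) c)"
        using range abc unfolding nonoverlapping_def by (fastforce simp: le_max_iff_disj)
      have "(\<Sum>k<K. max (y k) c - max (x k) c) \<le> (\<Sum>k<K. y k - x k)"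
        by (rule sum_mono) (use range in \<open>force simp: max_def\<close>)
      then show "(\<Sum>k<K. max (y k) c - max (x k) c) < \<delta>2" using len by simp
    qed
    moreover have "(\<Sum>k<K. dist (f (x k)) (f (y k))) \<le> (\<Sum>k<K. dist (f (min (x k) c)) (f (min (y k) c)))
        + (\<Sum>k<K. dist (f (max (x k) c)) (f (max (y k) c)))"
      unfolding sum.distrib[symmetric]
    proof (rule sum_mono)
      fix k assume "k \<in> {..<K}"
      then have "x k \<le> y k" using range by simp
      \<comment> \<open>The triangle inequality through \<open>f c\<close> is used when
        \<open>c\<close> lies in the interval; otherwise one summand is zero and the other is the
        left side.\<close>
      then show "dist (f (x k)) (f (y k)) \<le> dist (f (min (x k) c)) (f (min (y k) c))
          + dist (f (max (x k) c)) (f (max (y k) c))"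
        by (auto simp: min_def max_def dist_triangle)
    qed
    ultimately show ?thesis by simp
  qed
  moreover have "min \<delta>1 \<delta>2 > 0" using \<delta>1(1) \<delta>2(1) by simp
  ultimately show "\<exists>\<delta>>0. \<forall>K x y. nonoverlapping {a..b} K x y \<longrightarrow>
      (\<Sum>k<K. y k - x k) < \<delta> \<longrightarrow> (\<Sum>k<K. dist (f (x k)) (f (y k))) < \<epsilon>"
    by (intro exI[of _ "min \<delta>1 \<delta>2"]) auto
qed

subsection \<open>Concatenation of controls\<close>

lemma admissible_control_concat:
  assumes u1: "admissible_control m M T1 u1" and u2: "admissible_control m M T2 u2"
    and T: "T1 > 0" "T2 > 0"
  shows "admissible_control m M (T1 + T2) (\<lambda>j t. if t \<le> T1 then u1 j t else u2 j (t - T1))"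
    (is "admissible_control m M _ ?u")
  unfolding admissible_control_def
proof (intro ballI conjI)
  fix j assume j: "j \<in> {1..m}"
  have meas1: "u1 j \<in> borel_measurable (lebesgue_on {0..T1})"
    and ae1: "negligible {t \<in> {0..T1}. \<not> \<bar>u1 j t\<bar> \<le> M}"
    and meas2: "u2 j \<in> borel_measurable (lebesgue_on {0..T2})"
    and ae2: "negligible {t \<in> {0..T2}. \<not> \<bar>u2 j t\<bar> \<le> M}"
    using u1 u2 j by (simp_all add: admissible_control_def AE_lebesgue_on_Icc_iff_negligible)
  have "(\<lambda>t. u2 j (t - T1)) \<in> borel_measurable (lebesgue_on {T1<..T1 + T2})"
  proof -
    \<comment> \<open>Composing with a Lebesgue measurable function requires measurability between
      the completed sigma-algebras, which continuity alone does not give; a translation has it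
      because it preserves null sets.\<close>
    have shift: "(\<lambda>t::real. t - T1) \<in> lebesgue \<rightarrow>\<^sub>M lebesgue"
      using lebesgue_affine_measurable[of "\<lambda>_. 1" "- T1"] by simp
    have "(\<lambda>t. t - T1) \<in> lebesgue_on {T1<..T1 + T2} \<rightarrow>\<^sub>M lebesgue_on {0..T2}"
      by (intro measurable_restrict_space2 measurable_restrict_space1 shift)
        (auto simp: space_restrict_space)
    from measurable_compose[OF this meas2] show ?thesis .
  qed
  moreover have "?u j \<in> borel_measurable (lebesgue_on {T1<..T1 + T2})
      \<longleftrightarrow> (\<lambda>t. u2 j (t - T1)) \<in> borel_measurable (lebesgue_on {T1<..T1 + T2})"
    by (rule measurable_cong) (auto simp: space_restrict_space)
  moreover have "?u j \<in> borel_measurable (lebesgue_on {0..T1})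
      \<longleftrightarrow> u1 j \<in> borel_measurable (lebesgue_on {0..T1})"
    by (rule measurable_cong) (auto simp: space_restrict_space)
  ultimately have pieces: "?u j \<in> borel_measurable (lebesgue_on {0..T1})"
      "?u j \<in> borel_measurable (lebesgue_on {T1<..T1 + T2})"
    using meas1 by auto
  show "?u j \<in> borel_measurable (lebesgue_on {0..T1 + T2})"
  proof (rule measurable_piecewise_restrict[of "{{0..T1}, {T1<..T1 + T2}}"])
    show "?u j \<in> borel_measurable (restrict_space (lebesgue_on {0..T1 + T2}) \<Omega>)"
      if "\<Omega> \<in> {{0..T1}, {T1<..T1 + T2}}" for \<Omega>
    proof -
      have "{0..T1 + T2} \<inter> \<Omega> = \<Omega>" using that T by auto
      moreover have "\<Omega> \<in> sets lebesgue" using that by auto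
      ultimately show ?thesis
        using pieces that by (auto simp: restrict_restrict_space)
    qed
    show "\<Omega> \<inter> space (lebesgue_on {0..T1 + T2}) \<in> sets (lebesgue_on {0..T1 + T2})"
      if "\<Omega> \<in> {{0..T1}, {T1<..T1 + T2}}" for \<Omega>
    proof -
      have "\<Omega> \<subseteq> {0..T1 + T2}" "\<Omega> \<in> sets lebesgue" using that T by auto
      then show ?thesis by (simp add: sets_restrict_space_iff space_restrict_space Int_absorb2)
    qed
  qed (use T in \<open>auto simp: space_restrict_space\<close>)
  have "negligible ({t \<in> {0..T1}. \<not> \<bar>u1 j t\<bar> \<le> M}
      \<union> (+) T1 ` {t \<in> {0..T2}. \<not> \<bar>u2 j t\<bar> \<le> M})"
    by (intro negligible_Un ae1 negligible_translation ae2)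
  moreover have "{t \<in> {0..T1 + T2}. \<not> \<bar>?u j t\<bar> \<le> M} \<subseteq> \<dots>"
  proof
    fix t assume t: "t \<in> {t \<in> {0..T1 + T2}. \<not> \<bar>?u j t\<bar> \<le> M}"
    show "t \<in> {t \<in> {0..T1}. \<not> \<bar>u1 j t\<bar> \<le> M} \<union> (+) T1 ` {t \<in> {0..T2}. \<not> \<bar>u2 j t\<bar> \<le> M}"
    proof (cases "t \<le> T1")
      case False
      with t have "t - T1 \<in> {t \<in> {0..T2}. \<not> \<bar>u2 j t\<bar> \<le> M}" by auto
      then have "T1 + (t - T1) \<in> (+) T1 ` {t \<in> {0..T2}. \<not> \<bar>u2 j t\<bar> \<le> M}" by (rule imageI)
      then show ?thesis by simp
    qed (use t in auto)
  qed
  ultimately show "AE t in lebesgue_on {0..T1 + T2}. \<bar>?u j t\<bar> \<le> M"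
    unfolding AE_lebesgue_on_Icc_iff_negligible by (rule negligible_subset)
qed

text \<open>The pointwise clause of \<open>is_propagator\<close>, isolated so that its exceptional
  set of times can be translated and united. \<open>T\<close> enters through the filter only, hence
  has no influence at interior times.\<close>

definition schroedinger_at ::
  "nat \<Rightarrow> nat \<Rightarrow> (nat \<Rightarrow> complex mat) \<Rightarrow> (nat \<Rightarrow> real \<Rightarrow> real) \<Rightarrow> real \<Rightarrow> (real \<Rightarrow> complex mat) \<Rightarrow> real \<Rightarrow> bool"
where
  "schroedinger_at N m H u T U t \<longleftrightarrow> (\<exists>V \<in> carrier_mat N N.
     (\<forall>r<N. \<forall>c<N. ((\<lambda>s. U s $$ (r, c)) has_vector_derivative V $$ (r, c)) (at t within {0..T}))
     \<and> \<i> \<cdot>\<^sub>m V = hamiltonian N m H u t * U t)"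

lemma is_propagator_iff:
  "is_propagator N m H u T U \<longleftrightarrow>
     (\<forall>t\<in>{0..T}. U t \<in> carrier_mat N N) \<and> U 0 = 1\<^sub>m N
     \<and> (\<forall>r<N. \<forall>c<N. abs_continuous_on {0..T} (\<lambda>t. U t $$ (r, c)))
     \<and> negligible {t \<in> {0..T}. \<not> schroedinger_at N m H u T U t}"
  unfolding is_propagator_def schroedinger_at_def AE_lebesgue_on_Icc_iff_negligible ..

text \<open>The equation is linear with the Hamiltonian acting from the left, so right
  multiplication by the constant \<open>U1 T1\<close> maps solutions to solutions.\<close>

lemma is_propagator_concat:
  assumes U1: "is_propagator N m H u1 T1 U1" and U2: "is_propagator N m H u2 T2 U2"
    and T: "T1 > 0" "T2 > 0"
  shows "is_propagator N m H (\<lambda>j t. if t \<le> T1 then u1 j t else u2 j (t - T1)) (T1 + T2)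
           (\<lambda>t. if t \<le> T1 then U1 t else U2 (t - T1) * U1 T1)"
    (is "is_propagator N m H ?u _ ?U")
proof -
  have c1: "U1 t \<in> carrier_mat N N" if "t \<in> {0..T1}" for t
    using U1 that by (simp add: is_propagator_iff)
  have c2: "U2 t \<in> carrier_mat N N" if "t \<in> {0..T2}" for t
    using U2 that by (simp add: is_propagator_iff)
  have init: "U1 0 = 1\<^sub>m N" "U2 0 = 1\<^sub>m N"
    using U1 U2 by (simp_all add: is_propagator_iff)
  define B where "B = U1 T1"
  have B: "B \<in> carrier_mat N N" using c1 T by (simp add: B_def)
  have entry: "(A * B) $$ (r, c) = (\<Sum>i<N. A $$ (r, i) * B $$ (i, c))"
    if "A \<in> carrier_mat N N" "r < N" "c < N" for A r c
    using that B by (simp add: scalar_prod_def atLeast0LessThan)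
  have carrier: "?U t \<in> carrier_mat N N" if "t \<in> {0..T1 + T2}" for t
    using that T c1[of t] c2[of "t - T1"] B by (auto simp: B_def[symmetric])
  \<comment> \<open>At \<open>t = T1\<close> the two branches agree because \<open>U2 0\<close> is
    the identity; this is what joins the pieces continuously.\<close>
  have U_right: "?U t = U2 (t - T1) * B" if "t \<in> {T1..T1 + T2}" for t
    using that T B init by (auto simp: B_def)
  have ac: "abs_continuous_on {0..T1 + T2} (\<lambda>t. ?U t $$ (r, c))" if rc: "r < N" "c < N" for r c
  proof (rule abs_continuous_on_combine)
    have "abs_continuous_on {0..T1} (\<lambda>t. U1 t $$ (r, c))"
      using U1 rc by (simp add: is_propagator_iff)
    then show "abs_continuous_on {0..T1} (\<lambda>t. ?U t $$ (r, c))"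
      by (rule abs_continuous_on_cong) simp
    have ac2: "abs_continuous_on {0..T2} (\<lambda>t. U2 t $$ (r, i))" if "i < N" for i
      using U2 rc that by (simp add: is_propagator_iff)
    \<comment> \<open>A bound on column \<open>c\<close> of \<open>B\<close>: the increments of an
      entry of the product are at most \<open>C\<close> times the summed increments of row
      \<open>r\<close> of \<open>U2\<close>.\<close>
    define C where "C = Max (insert 0 ((\<lambda>i. norm (B $$ (i, c))) ` {..<N}))"
    have C: "norm (B $$ (i, c)) \<le> C" if "i < N" for i
      using that by (simp add: C_def)
    have "abs_continuous_on {0..T2} (\<lambda>t. \<Sum>i<N. U2 t $$ (r, i) * B $$ (i, c))"
    proof (rule abs_continuous_on_dominated[of "{..<N}" _ "\<lambda>i t. U2 t $$ (r, i)"])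
      fix x y
      have "dist (\<Sum>i<N. U2 x $$ (r, i) * B $$ (i, c)) (\<Sum>i<N. U2 y $$ (r, i) * B $$ (i, c))
          = norm (\<Sum>i<N. (U2 x $$ (r, i) - U2 y $$ (r, i)) * B $$ (i, c))"
        by (simp add: dist_norm sum_subtractf[symmetric] left_diff_distrib)
      also have "\<dots> \<le> (\<Sum>i<N. norm (U2 x $$ (r, i) - U2 y $$ (r, i)) * C)"
        by (intro order_trans[OF norm_sum] sum_mono)
          (auto simp: norm_mult intro!: mult_left_mono C)
      finally show "dist (\<Sum>i<N. U2 x $$ (r, i) * B $$ (i, c)) (\<Sum>i<N. U2 y $$ (r, i) * B $$ (i, c))
          \<le> C * (\<Sum>i<N. dist (U2 x $$ (r, i)) (U2 y $$ (r, i)))"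
        by (simp add: dist_norm sum_distrib_left mult.commute)
    qed (use ac2 in auto)
    from abs_continuous_on_shift[OF this, of T1]
    have "abs_continuous_on {T1..T1 + T2} (\<lambda>t. \<Sum>i<N. U2 (t - T1) $$ (r, i) * B $$ (i, c))"
      by (simp add: add.commute)
    then show "abs_continuous_on {T1..T1 + T2} (\<lambda>t. ?U t $$ (r, c))"
    proof (rule abs_continuous_on_cong)
      fix t assume t: "t \<in> {T1..T1 + T2}"
      then have "U2 (t - T1) \<in> carrier_mat N N" by (intro c2) auto
      then show "(\<Sum>i<N. U2 (t - T1) $$ (r, i) * B $$ (i, c)) = ?U t $$ (r, c)"
        unfolding U_right[OF t] using rc by (simp add: entry)
    qed
  qed (use T in auto)
  have ae: "negligible {t \<in> {0..T1}. \<not> schroedinger_at N m H u1 T1 U1 t}"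
      "negligible {t \<in> {0..T2}. \<not> schroedinger_at N m H u2 T2 U2 t}"
    using U1 U2 by (simp_all only: is_propagator_iff)
  have ham: "hamiltonian N m H u t \<in> carrier_mat N N" for u t
    by (simp add: hamiltonian_def)
  have eq1: "schroedinger_at N m H ?u (T1 + T2) ?U t"
    if t: "0 < t" "t < T1" and eq: "schroedinger_at N m H u1 T1 U1 t" for t
  proof -
    from eq obtain V where V: "V \<in> carrier_mat N N" "\<i> \<cdot>\<^sub>m V = hamiltonian N m H u1 t * U1 t"
      and deriv: "\<And>r c. r < N \<Longrightarrow> c < N \<Longrightarrow>
        ((\<lambda>s. U1 s $$ (r, c)) has_vector_derivative V $$ (r, c)) (at t within {0..T1})"
      unfolding schroedinger_at_def by blast
    have "((\<lambda>s. ?U s $$ (r, c)) has_vector_derivative V $$ (r, c)) (at t within {0..T1 + T2})"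
      if "r < N" "c < N" for r c
    proof -
      have "((\<lambda>s. U1 s $$ (r, c)) has_vector_derivative V $$ (r, c)) (at t)"
        using deriv[OF that] t by (simp add: at_within_Icc_at)
      then have "((\<lambda>s. ?U s $$ (r, c)) has_vector_derivative V $$ (r, c)) (at t)"
        by (rule has_vector_derivative_transform_within_open[of _ _ _ "{..<T1}"]) (use t in auto)
      then show ?thesis by (rule has_vector_derivative_at_within)
    qed
    moreover have "hamiltonian N m H ?u t = hamiltonian N m H u1 t"
      using t by (simp add: hamiltonian_def)
    ultimately show ?thesis
      unfolding schroedinger_at_def using V t by (intro bexI[of _ V]) auto
  qed
  have eq2: "schroedinger_at N m H ?u (T1 + T2) ?U t"
    if t: "T1 < t" "t < T1 + T2" and eq: "schroedinger_at N m H u2 T2 U2 (t - T1)" for t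
  proof -
    from eq obtain V where V: "V \<in> carrier_mat N N"
        "\<i> \<cdot>\<^sub>m V = hamiltonian N m H u2 (t - T1) * U2 (t - T1)"
      and deriv: "\<And>r c. r < N \<Longrightarrow> c < N \<Longrightarrow>
        ((\<lambda>s. U2 s $$ (r, c)) has_vector_derivative V $$ (r, c)) (at (t - T1) within {0..T2})"
      unfolding schroedinger_at_def by blast
    have "((\<lambda>s. ?U s $$ (r, c)) has_vector_derivative (V * B) $$ (r, c)) (at t within {0..T1 + T2})"
      if rc: "r < N" "c < N" for r c
    proof -
      have "((\<lambda>s. U2 (s - T1) $$ (r, i)) has_vector_derivative V $$ (r, i)) (at t)"
        if "i < N" for i
      proof -
        have "((\<lambda>s. U2 s $$ (r, i)) has_vector_derivative V $$ (r, i)) (at (t - T1))"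
          using deriv[OF \<open>r < N\<close> that] t by (simp add: at_within_Icc_at)
        moreover have "((\<lambda>s. s - T1) has_vector_derivative 1) (at t)"
          by (auto intro!: derivative_eq_intros)
        ultimately show ?thesis
          using vector_diff_chain_at[of "\<lambda>s. s - T1" 1 t "\<lambda>s. U2 s $$ (r, i)" "V $$ (r, i)"]
          by (simp add: o_def)
      qed
      then have "((\<lambda>s. \<Sum>i<N. U2 (s - T1) $$ (r, i) * B $$ (i, c)) has_vector_derivative
          (\<Sum>i<N. V $$ (r, i) * B $$ (i, c))) (at t)"
        by (intro has_vector_derivative_sum has_vector_derivative_mult_left) auto
      then have "((\<lambda>s. ?U s $$ (r, c)) has_vector_derivative
          (\<Sum>i<N. V $$ (r, i) * B $$ (i, c))) (at t)"
      proof (rule has_vector_derivative_transform_within_open[of _ _ _ "{T1<..<T1 + T2}"])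
        fix s assume s: "s \<in> {T1<..<T1 + T2}"
        then have "U2 (s - T1) \<in> carrier_mat N N" by (intro c2) auto
        then show "(\<Sum>i<N. U2 (s - T1) $$ (r, i) * B $$ (i, c)) = ?U s $$ (r, c)"
          using s rc by (simp add: B_def[symmetric] entry)
      qed (use t in auto)
      then show ?thesis
        using entry[OF V(1) rc] by (simp add: has_vector_derivative_at_within)
    qed
    moreover have "hamiltonian N m H ?u t = hamiltonian N m H u2 (t - T1)"
      using t by (simp add: hamiltonian_def)
    moreover have "\<i> \<cdot>\<^sub>m (V * B) = hamiltonian N m H u2 (t - T1) * (U2 (t - T1) * B)"
    proof -
      have "U2 (t - T1) \<in> carrier_mat N N" using t by (intro c2) auto
      then have "hamiltonian N m H u2 (t - T1) * (U2 (t - T1) * B) = (\<i> \<cdot>\<^sub>m V) * B"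
        using V(2) assoc_mult_mat[OF ham _ B] by metis
      then show ?thesis using mult_smult_assoc_mat[OF V(1) B] by simp
    qed
    ultimately show ?thesis
      unfolding schroedinger_at_def using V(1) B t by (intro bexI[of _ "V * B"]) (auto simp: B_def[symmetric])
  qed
  \<comment> \<open>The three endpoints join the exceptional set: this avoids one-sided derivatives
    at \<open>0\<close> and \<open>T1 + T2\<close>, and at \<open>T1\<close> the curve need not be
    differentiable.\<close>
  have "negligible ({t \<in> {0..T1}. \<not> schroedinger_at N m H u1 T1 U1 t}
      \<union> (+) T1 ` {t \<in> {0..T2}. \<not> schroedinger_at N m H u2 T2 U2 t} \<union> {0, T1, T1 + T2})"
    by (intro negligible_Un negligible_translation ae negligible_finite) auto
  moreover have "{t \<in> {0..T1 + T2}. \<not> schroedinger_at N m H ?u (T1 + T2) ?U t} \<subseteq> \<dots>"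
  proof
    fix t assume t: "t \<in> {t \<in> {0..T1 + T2}. \<not> schroedinger_at N m H ?u (T1 + T2) ?U t}"
    consider "0 < t" "t < T1" | "T1 < t" "t < T1 + T2" | "t \<in> {0, T1, T1 + T2}"
      using t by force
    then show "t \<in> {t \<in> {0..T1}. \<not> schroedinger_at N m H u1 T1 U1 t}
      \<union> (+) T1 ` {t \<in> {0..T2}. \<not> schroedinger_at N m H u2 T2 U2 t} \<union> {0, T1, T1 + T2}"
    proof cases
      case 1
      then have "\<not> schroedinger_at N m H u1 T1 U1 t" using t eq1[of t] by blast
      then show ?thesis using 1 by simp
    next
      case 2
      then have "\<not> schroedinger_at N m H u2 T2 U2 (t - T1)" using t eq2[of t] by blast
      then have "t - T1 \<in> {t \<in> {0..T2}. \<not> schroedinger_at N m H u2 T2 U2 t}" using 2 by simp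
      then have "T1 + (t - T1) \<in> (+) T1 ` {t \<in> {0..T2}. \<not> schroedinger_at N m H u2 T2 U2 t}" by (rule imageI)
      then show ?thesis by simp
    next
      case 3
      then show ?thesis by (rule UnI2)
    qed
  qed
  ultimately have "negligible {t \<in> {0..T1 + T2}. \<not> schroedinger_at N m H ?u (T1 + T2) ?U t}"
    by (rule negligible_subset)
  then show ?thesis
    unfolding is_propagator_iff using carrier ac init T by simp
qed

lemma steers_mult:
  assumes "steers N m H M T1 u1 A" "steers N m H M T2 u2 B" "T1 > 0" "T2 > 0"
  shows "\<exists>u. steers N m H M (T1 + T2) u (B * A)"
proof -
  obtain U1 U2 where U: "is_propagator N m H u1 T1 U1" "U1 T1 = A"
      "is_propagator N m H u2 T2 U2" "U2 T2 = B"
    using assms by (auto simp: steers_def)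
  have "(if T1 + T2 \<le> T1 then U1 (T1 + T2) else U2 (T1 + T2 - T1) * U1 T1) = B * A"
    using U assms by simp
  then show ?thesis
    using admissible_control_concat[of m M T1 u1 T2 u2] is_propagator_concat[OF U(1,3)] assms
    unfolding steers_def by blast
qed

section \<open>Subadditivity of the minimal time\<close>

lemma min_time_less_iff:
  "min_time N m H M \<Gamma> < ereal b \<longleftrightarrow> (\<exists>T>0. T < b \<and> (\<exists>u. steers N m H M T u \<Gamma>))"
proof
  assume "min_time N m H M \<Gamma> < ereal b"
  then show "\<exists>T>0. T < b \<and> (\<exists>u. steers N m H M T u \<Gamma>)"
    unfolding min_time_def Inf_less_iff by auto
next
  assume "\<exists>T>0. T < b \<and> (\<exists>u. steers N m H M T u \<Gamma>)"
  then obtain T where "T > 0" "T < b" "\<exists>u. steers N m H M T u \<Gamma>" by blast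
  then show "min_time N m H M \<Gamma> < ereal b"
    unfolding min_time_def Inf_less_iff by (intro bexI[of _ "ereal T"]) auto
qed

text \<open>Near-optimal controls exceeding each bound by less than half of \<epsilon> exist even if
  the infimum is not attained; running them in succession exceeds \<open>a + b\<close> by less than
  \<epsilon>.\<close>

lemma min_time_mult_le:
  assumes A: "min_time N m H M A \<le> ereal a" and B: "min_time N m H M B \<le> ereal b"
  shows "min_time N m H M (B * A) \<le> ereal (a + b)"
proof (rule ereal_le_epsilon2)
  fix \<epsilon> :: real assume "\<epsilon> > 0"
  then have lt: "ereal a < ereal (a + \<epsilon> / 2)" "ereal b < ereal (b + \<epsilon> / 2)" by simp_all
  obtain T1 u1 where 1: "T1 > 0" "T1 < a + \<epsilon> / 2" "steers N m H M T1 u1 A"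
    using le_less_trans[OF A lt(1)] unfolding min_time_less_iff by blast
  obtain T2 u2 where 2: "T2 > 0" "T2 < b + \<epsilon> / 2" "steers N m H M T2 u2 B"
    using le_less_trans[OF B lt(2)] unfolding min_time_less_iff by blast
  obtain u where u: "steers N m H M (T1 + T2) u (B * A)"
    using steers_mult[OF 1(3) 2(3) 1(1) 2(1)] by blast
  have "T1 + T2 > 0" "T1 + T2 < a + b + \<epsilon>" using 1 2 by linarith+
  with u have "min_time N m H M (B * A) < ereal (a + b + \<epsilon>)"
    unfolding min_time_less_iff by blast
  then show "min_time N m H M (B * A) \<le> ereal (a + b) + ereal \<epsilon>" by simp
qed

subsection \<open>Elementary gates\<close>

lemma mult_mat_entry:
  assumes "A \<in> carrier_mat N N" "B \<in> carrier_mat N N" "r < N" "c < N"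
  shows "(A * B) $$ (r, c) = (\<Sum>i<N. A $$ (r, i) * B $$ (i, c))"
  using assms by (simp add: scalar_prod_def atLeast0LessThan)

lemma mat_adjoint_entry:
  fixes A :: "complex mat"
  assumes "A \<in> carrier_mat N N" "r < N" "c < N"
  shows "mat_adjoint A $$ (r, c) = cnj (A $$ (c, r))"
  using assms by (simp add: mat_adjoint_def mat_of_rows_def)

text \<open>For square matrices a left inverse is a right inverse, so orthonormal columns
  suffice.\<close>

lemma unitary_opI:
  assumes A: "A \<in> carrier_mat N N"
    and ortho: "\<And>r c. \<lbrakk>r < N; c < N\<rbrakk> \<Longrightarrow> (\<Sum>i<N. cnj (A $$ (i, r)) * A $$ (i, c)) = of_bool (r = c)"
  shows "unitary_op N A"
proof -
  have A': "mat_adjoint A \<in> carrier_mat N N"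
    using A by (simp add: mat_adjoint_def mat_of_rows_def)
  have "mat_adjoint A * A = 1\<^sub>m N"
  proof (rule eq_matI)
    fix r c assume "r < dim_row (1\<^sub>m N :: complex mat)" "c < dim_col (1\<^sub>m N :: complex mat)"
    then show "(mat_adjoint A * A) $$ (r, c) = 1\<^sub>m N $$ (r, c)"
      using A A' ortho[of r c]
      by (simp add: mult_mat_entry mat_adjoint_entry del: index_mult_mat)
  qed (use A A' in auto)
  with A A' show ?thesis
    unfolding unitary_op_def using mat_mult_left_right_inverse by blast
qed

section \<open>Basis indices prescribed by their binary digits\<close>

definition from_bits :: "nat \<Rightarrow> (nat \<Rightarrow> bool) \<Rightarrow> nat" where
  "from_bits n f = horner_sum of_bool 2 (map f [0..<n])"

lemma bit_from_bits: "bit (from_bits n f) p \<longleftrightarrow> p < n \<and> f p"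
  by (auto simp: from_bits_def bit_horner_sum_bit_iff)

lemma from_bits_less: "from_bits n f < 2 ^ n"
  using horner_sum_of_bool_2_less[of "map f [0..<n]"] by (simp add: from_bits_def)

lemma nat_eq_iff_bits:
  fixes x y :: nat
  assumes "x < 2 ^ n" "y < 2 ^ n"
  shows "x = y \<longleftrightarrow> (\<forall>p<n. bit x p = bit y p)"
proof
  assume *: "\<forall>p<n. bit x p = bit y p"
  have "take_bit n x = take_bit n y" by (rule bit_eqI) (use * in \<open>auto simp: bit_take_bit_iff\<close>)
  then show "x = y" using assms by (simp add: take_bit_nat_eq_self)
qed simp

definition with_bit :: "nat \<Rightarrow> nat \<Rightarrow> bool \<Rightarrow> nat \<Rightarrow> nat" where
  "with_bit n q b x = from_bits n (\<lambda>p. if p = q then b else bit x p)"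

lemma bit_with_bit: "bit (with_bit n q b x) p \<longleftrightarrow> p < n \<and> (if p = q then b else bit x p)"
  by (simp add: with_bit_def bit_from_bits)

lemma with_bit_less: "with_bit n q b x < 2 ^ n"
  by (simp add: with_bit_def from_bits_less)

text \<open>Exactly two indices agree with \<open>x\<close> off position \<open>q\<close>. This
  reduces a matrix product with a one-qubit gate to two terms.\<close>

lemma sum_over_qubit:
  assumes "q < n" "\<And>y. \<lbrakk>y < 2 ^ n; \<not> (\<forall>p<n. p \<noteq> q \<longrightarrow> bit x p = bit y p)\<rbrakk> \<Longrightarrow> g y = 0"
  shows "(\<Sum>y<2 ^ n. g y) = g (with_bit n q False x) + g (with_bit n q True x)"
proof -
  have ne: "with_bit n q False x \<noteq> with_bit n q True x"
    using bit_with_bit[of n q _ x q] \<open>q < n\<close> by metis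
  have "(\<Sum>y<2 ^ n. g y) = sum g {with_bit n q False x, with_bit n q True x}"
  proof (rule sum.mono_neutral_right)
    show "\<forall>y\<in>{..<2 ^ n} - {with_bit n q False x, with_bit n q True x}. g y = 0"
    proof
      fix y assume y: "y \<in> {..<2 ^ n} - {with_bit n q False x, with_bit n q True x}"
      then have ne: "y \<noteq> with_bit n q (bit y q) x" by (cases "bit y q") auto
      have "\<not> (\<forall>p<n. p \<noteq> q \<longrightarrow> bit x p = bit y p)"
      proof
        assume "\<forall>p<n. p \<noteq> q \<longrightarrow> bit x p = bit y p"
        then have "y = with_bit n q (bit y q) x"
          using y by (subst nat_eq_iff_bits[of _ n]) (auto simp: with_bit_less bit_with_bit)
        with ne show False ..
      qed
      then show "g y = 0" using y assms(2) by simp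
    qed
  qed (auto simp: with_bit_less)
  then show ?thesis using ne by simp
qed

text \<open>
  From here on qubits are addressed by the position \<open>p < n\<close> of their digit in the binary expansion;
  position \<open>p\<close> is tensor factor \<open>n - p\<close>.
\<close>

lemma elementary_gateI:
  assumes "unitary_op (2 ^ n) G" "P \<subseteq> {..<n}" "card P \<le> 2"
    and G: "\<And>x y. \<lbrakk>x < 2 ^ n; y < 2 ^ n\<rbrakk> \<Longrightarrow> G $$ (x, y) =
      (if \<forall>p\<in>{..<n} - P. bit x p = bit y p
       then F (\<lambda>p. p \<in> P \<and> bit x p) (\<lambda>p. p \<in> P \<and> bit y p) else 0)"
  shows "elementary_gate n G"
proof -
  define S where "S = (\<lambda>p. n - p) ` P"
  have "finite P" using assms(2) finite_subset by blast
  then have "card S \<le> 2" using card_image_le[of P "\<lambda>p. n - p"] assms(3) by (simp add: S_def)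
  moreover have "S \<subseteq> {1..n}" using assms(2) by (force simp: S_def)
  moreover have "acts_only_on n S G"
    unfolding acts_only_on_def
  proof (intro conjI exI allI impI)
    show "G \<in> carrier_mat (2 ^ n) (2 ^ n)" using assms(1) by (simp add: unitary_op_def)
    fix x y :: nat assume xy: "x < 2 ^ n" "y < 2 ^ n"
    have qv: "qubit_value n z j = of_bool (bit z (n - j))" for z j
      by (simp add: qubit_value_def bit_iff_odd mod_2_eq_odd)
    \<comment> \<open>\<open>A\<close> sees only restricted assignments, which are undefined off
      \<open>S\<close>; the conjunct \<open>p \<in> P\<close> keeps those values away from
      \<open>F\<close>.\<close>
    let ?A = "\<lambda>f g. F (\<lambda>p. p \<in> P \<and> f (n - p) = (1::nat)) (\<lambda>p. p \<in> P \<and> g (n - p) = (1::nat))"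
    have restr: "(\<lambda>p. p \<in> P \<and> restrict (qubit_value n z) S (n - p) = 1) = (\<lambda>p. p \<in> P \<and> bit z p)" for z
    proof (intro ext conj_cong refl)
      fix p assume "p \<in> P"
      then have "n - p \<in> S" "n - (n - p) = p" using assms(2) by (auto simp: S_def)
      then show "restrict (qubit_value n z) S (n - p) = 1 \<longleftrightarrow> bit z p" by (simp add: qv)
    qed
    have "(\<forall>p\<in>{..<n} - P. bit x p = bit y p) \<longleftrightarrow> (\<forall>j\<in>{1..n} - S. qubit_value n x j = qubit_value n y j)"
    proof -
      have "{1..n} - S = (\<lambda>p. n - p) ` ({..<n} - P)"
      proof (intro equalityI subsetI)
        fix j assume j: "j \<in> {1..n} - S"
        then have "n - j \<notin> P" "n - j < n" "j = n - (n - j)" by (force simp: S_def)+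
        then show "j \<in> (\<lambda>p. n - p) ` ({..<n} - P)" by blast
      next
        fix j assume "j \<in> (\<lambda>p. n - p) ` ({..<n} - P)"
        then obtain p where p: "j = n - p" "p < n" "p \<notin> P" by auto
        \<comment> \<open>Truncated subtraction from \<open>n\<close> is injective only on arguments
          up to \<open>n\<close>, hence the appeal to \<open>P \<subseteq> {..<n}\<close>.\<close>
        then have "n - p \<noteq> n - p'" if "p' \<in> P" for p'
          using that assms(2) by (metis diff_diff_cancel lessThan_iff less_imp_le subsetD)
        with p show "j \<in> {1..n} - S" by (auto simp: S_def)
      qed
      then show ?thesis by (auto simp: qv)
    qed
    then have deltas: "(\<Prod>j\<in>{1..n} - S. if qubit_value n x j = qubit_value n y j then 1 else 0 :: complex)
        = (if \<forall>p\<in>{..<n} - P. bit x p = bit y p then 1 else 0)"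
      by auto
    show "G $$ (x, y) = ?A (restrict (qubit_value n x) S) (restrict (qubit_value n y) S)
        * (\<Prod>j\<in>{1..n} - S. if qubit_value n x j = qubit_value n y j then 1 else 0)"
      unfolding G[OF xy] deltas restr by simp
  qed
  ultimately show ?thesis using assms(1) by (auto simp: elementary_gate_def)
qed

section \<open>Diagonal operators and controlled phases\<close>

definition diagonal_op :: "nat \<Rightarrow> (nat \<Rightarrow> complex) \<Rightarrow> complex mat" where
  "diagonal_op n f = mat (2 ^ n) (2 ^ n) (\<lambda>(x, y). if x = y then f x else 0)"

lemma diagonal_op_carrier [simp]: "diagonal_op n f \<in> carrier_mat (2 ^ n) (2 ^ n)"
  by (simp add: diagonal_op_def)

lemma diagonal_op_mult_entry:
  assumes "A \<in> carrier_mat (2 ^ n) (2 ^ n)" "x < 2 ^ n" "z < 2 ^ n"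
  shows "(diagonal_op n f * A) $$ (x, z) = f x * A $$ (x, z)"
proof -
  have "(diagonal_op n f * A) $$ (x, z) = (\<Sum>y<2 ^ n. (if x = y then f x else 0) * A $$ (y, z))"
    using assms by (simp add: mult_mat_entry[OF diagonal_op_carrier]) (simp add: diagonal_op_def)
  also have "\<dots> = (\<Sum>y<2 ^ n. if x = y then f x * A $$ (y, z) else 0)"
    by (intro sum.cong) auto
  also have "\<dots> = f x * A $$ (x, z)"
    using assms by simp
  finally show ?thesis .
qed

lemma diagonal_op_mult: "diagonal_op n f * diagonal_op n g = diagonal_op n (\<lambda>x. f x * g x)"
proof (rule eq_matI)
  fix x y assume "x < dim_row (diagonal_op n (\<lambda>x. f x * g x))" "y < dim_col (diagonal_op n (\<lambda>x. f x * g x))"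
  then have "x < 2 ^ n" "y < 2 ^ n" by (simp_all add: diagonal_op_def)
  then show "(diagonal_op n f * diagonal_op n g) $$ (x, y) = diagonal_op n (\<lambda>x. f x * g x) $$ (x, y)"
    by (simp add: diagonal_op_mult_entry del: index_mult_mat) (simp add: diagonal_op_def)
qed (simp_all add: diagonal_op_def)

lemma unitary_diagonal_op:
  assumes "\<And>x. cmod (f x) = 1"
  shows "unitary_op (2 ^ n) (diagonal_op n f)"
proof (rule unitary_opI)
  fix r c :: nat assume rc: "r < 2 ^ n" "c < 2 ^ n"
  have "(\<Sum>i<2 ^ n. cnj (diagonal_op n f $$ (i, r)) * diagonal_op n f $$ (i, c))
      = (\<Sum>i<2 ^ n. if i = r then of_bool (r = c) else 0)"
  proof (rule sum.cong)
    fix i :: nat assume "i \<in> {..<2 ^ n}"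
    then show "cnj (diagonal_op n f $$ (i, r)) * diagonal_op n f $$ (i, c)
        = (if i = r then of_bool (r = c) else 0)"
      using rc assms[of r] by (auto simp: diagonal_op_def complex_norm_square[symmetric] mult.commute)
  qed simp
  then show "(\<Sum>i<2 ^ n. cnj (diagonal_op n f $$ (i, r)) * diagonal_op n f $$ (i, c)) = of_bool (r = c)"
    using rc by simp
qed simp

definition controlled_phase :: "nat \<Rightarrow> nat \<Rightarrow> nat \<Rightarrow> real \<Rightarrow> complex mat" where
  "controlled_phase n q p \<theta> = diagonal_op n (\<lambda>x. if bit x q \<and> bit x p then cis \<theta> else 1)"

text \<open>The diagonal condition \<open>x = y\<close> splits into agreement off
  \<open>{q, p}\<close>, which is the identity part, and agreement at \<open>q\<close> and
  \<open>p\<close>, which \<open>F\<close> has to test itself.\<close>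

lemma elementary_controlled_phase:
  assumes "q < n" "p < n"
  shows "elementary_gate n (controlled_phase n q p \<theta>)"
proof (rule elementary_gateI[where P = "{q, p}" and
      F = "\<lambda>f g. if f q = g q \<and> f p = g p then if f q \<and> f p then cis \<theta> else 1 else 0"])
  show "unitary_op (2 ^ n) (controlled_phase n q p \<theta>)"
    unfolding controlled_phase_def by (rule unitary_diagonal_op) simp
  show "card {q, p} \<le> 2" by (simp add: card_insert_if)
  fix x y :: nat assume xy: "x < 2 ^ n" "y < 2 ^ n"
  have "x = y \<longleftrightarrow> (\<forall>r\<in>{..<n} - {q, p}. bit x r = bit y r) \<and> bit x q = bit y q \<and> bit x p = bit y p"
    unfolding nat_eq_iff_bits[OF xy] using assms by auto
  then show "controlled_phase n q p \<theta> $$ (x, y) = (if \<forall>r\<in>{..<n} - {q, p}. bit x r = bit y r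
      then if (q \<in> {q, p} \<and> bit x q) = (q \<in> {q, p} \<and> bit y q)
             \<and> (p \<in> {q, p} \<and> bit x p) = (p \<in> {q, p} \<and> bit y p)
           then if (q \<in> {q, p} \<and> bit x q) \<and> p \<in> {q, p} \<and> bit x p then cis \<theta> else 1 else 0 else 0)"
    using xy by (simp add: controlled_phase_def diagonal_op_def)
qed (use assms in auto)

section \<open>The Hadamard gate on one qubit\<close>

definition hadamard :: "nat \<Rightarrow> nat \<Rightarrow> complex mat" where
  "hadamard n q = mat (2 ^ n) (2 ^ n) (\<lambda>(x, y).
     if \<forall>p<n. p \<noteq> q \<longrightarrow> bit x p = bit y p
     then (if bit x q \<and> bit y q then - 1 else 1) / complex_of_real (sqrt 2) else 0)"

lemma hadamard_carrier [simp]: "hadamard n q \<in> carrier_mat (2 ^ n) (2 ^ n)"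
  by (simp add: hadamard_def)

lemma hadamard_mult_entry:
  assumes "A \<in> carrier_mat (2 ^ n) (2 ^ n)" "q < n" "x < 2 ^ n" "z < 2 ^ n"
  shows "(hadamard n q * A) $$ (x, z) =
    (A $$ (with_bit n q False x, z) + (if bit x q then - 1 else 1) * A $$ (with_bit n q True x, z))
      / complex_of_real (sqrt 2)"
proof -
  have "(hadamard n q * A) $$ (x, z) = (\<Sum>y<2 ^ n. hadamard n q $$ (x, y) * A $$ (y, z))"
    using assms by (simp add: mult_mat_entry del: index_mult_mat)
  also have "\<dots> = hadamard n q $$ (x, with_bit n q False x) * A $$ (with_bit n q False x, z)
      + hadamard n q $$ (x, with_bit n q True x) * A $$ (with_bit n q True x, z)"
    by (rule sum_over_qubit) (use assms in \<open>auto simp: hadamard_def\<close>)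
  also have "\<dots> = (A $$ (with_bit n q False x, z)
      + (if bit x q then - 1 else 1) * A $$ (with_bit n q True x, z)) / complex_of_real (sqrt 2)"
    using assms by (simp add: hadamard_def with_bit_less bit_with_bit add_divide_distrib)
  finally show ?thesis .
qed

text \<open>Columns whose indices differ off \<open>q\<close> have disjoint supports. For the
  others, orthonormality is that of the 2 by 2 matrix with rows \<open>(1, 1)\<close> and
  \<open>(1, -1)\<close>, divided by \<open>sqrt 2\<close>.\<close>

lemma unitary_hadamard:
  assumes "q < n"
  shows "unitary_op (2 ^ n) (hadamard n q)"
proof (rule unitary_opI)
  fix r c :: nat assume rc: "r < 2 ^ n" "c < 2 ^ n"
  let ?s = "complex_of_real (sqrt 2)"
  have s: "?s * ?s = 2" by (simp flip: of_real_mult)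
  have "(\<Sum>i<2 ^ n. cnj (hadamard n q $$ (i, r)) * hadamard n q $$ (i, c))
      = cnj (hadamard n q $$ (with_bit n q False r, r)) * hadamard n q $$ (with_bit n q False r, c)
      + cnj (hadamard n q $$ (with_bit n q True r, r)) * hadamard n q $$ (with_bit n q True r, c)"
    by (rule sum_over_qubit) (use assms rc in \<open>auto simp: hadamard_def\<close>)
  also have "\<dots> = of_bool (r = c)"
  proof (cases "\<forall>p<n. p \<noteq> q \<longrightarrow> bit r p = bit c p")
    case True
    then have "r = c \<longleftrightarrow> bit r q = bit c q"
      using nat_eq_iff_bits[OF rc] assms by metis
    then show ?thesis
      using True rc s assms by (auto simp: hadamard_def with_bit_less bit_with_bit)
  next
    case False
    then have "r \<noteq> c" by auto
    moreover have "hadamard n q $$ (with_bit n q b r, c) = 0" for b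
      using False rc by (auto simp: hadamard_def with_bit_less bit_with_bit)
    ultimately show ?thesis by simp
  qed
  finally show "(\<Sum>i<2 ^ n. cnj (hadamard n q $$ (i, r)) * hadamard n q $$ (i, c)) = of_bool (r = c)" .
qed simp

lemma elementary_hadamard:
  assumes "q < n"
  shows "elementary_gate n (hadamard n q)"
  by (rule elementary_gateI[where P = "{q}" and
      F = "\<lambda>f g. (if f q \<and> g q then - 1 else 1) / complex_of_real (sqrt 2)"])
    (use assms unitary_hadamard in \<open>auto simp: hadamard_def\<close>)

section \<open>Permutations of the qubits\<close>

definition permutation_op :: "nat \<Rightarrow> (nat \<Rightarrow> nat) \<Rightarrow> complex mat" where
  "permutation_op n \<pi> = mat (2 ^ n) (2 ^ n) (\<lambda>(x, y). if \<forall>p<n. bit y p = bit x (\<pi> p) then 1 else 0)"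

lemma permutation_op_carrier [simp]: "permutation_op n \<pi> \<in> carrier_mat (2 ^ n) (2 ^ n)"
  by (simp add: permutation_op_def)

lemma permutation_op_entry:
  assumes "x < 2 ^ n" "y < 2 ^ n"
  shows "permutation_op n \<pi> $$ (x, y) = (if y = from_bits n (\<lambda>p. bit x (\<pi> p)) then 1 else 0)"
  using assms by (simp add: permutation_op_def nat_eq_iff_bits[OF _ from_bits_less] bit_from_bits)

text \<open>Row \<open>x\<close> has its only nonzero entry in the column whose digit
  \<open>p\<close> is digit \<open>\<pi> p\<close> of \<open>x\<close>. Hence left multiplication
  merely substitutes a row index; for a permutation, the state of position \<open>p\<close> moves to
  position \<open>\<pi> p\<close>.\<close>

lemma permutation_op_mult_entry:
  assumes "A \<in> carrier_mat (2 ^ n) (2 ^ n)" "x < 2 ^ n" "z < 2 ^ n"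
  shows "(permutation_op n \<pi> * A) $$ (x, z) = A $$ (from_bits n (\<lambda>p. bit x (\<pi> p)), z)"
proof -
  let ?y = "from_bits n (\<lambda>p. bit x (\<pi> p))"
  have "(permutation_op n \<pi> * A) $$ (x, z) = (\<Sum>y<2 ^ n. if y = ?y then A $$ (y, z) else 0)"
    using assms from_bits_less
    by (simp add: mult_mat_entry[OF permutation_op_carrier] permutation_op_entry if_distrib[of "\<lambda>a. a * _"]
      cong: if_cong del: index_mult_mat)
  then show ?thesis by (simp add: from_bits_less)
qed

text \<open>Reading digits through \<open>\<pi>\<close> and the result through \<open>\<rho>\<close>
  reads digit \<open>\<pi> (\<rho> p)\<close>. The bound on \<open>\<rho>\<close> matters since
  \<open>from_bits n\<close> clears every digit from position \<open>n\<close> on.\<close>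

lemma permutation_op_mult:
  assumes "\<And>p. p < n \<Longrightarrow> \<rho> p < n" "\<And>p. p < n \<Longrightarrow> \<sigma> p = \<pi> (\<rho> p)"
  shows "permutation_op n \<pi> * permutation_op n \<rho> = permutation_op n \<sigma>"
proof (rule eq_matI)
  fix x y assume "x < dim_row (permutation_op n \<sigma>)" "y < dim_col (permutation_op n \<sigma>)"
  then have xy: "x < 2 ^ n" "y < 2 ^ n" by (simp_all add: permutation_op_def)
  show "(permutation_op n \<pi> * permutation_op n \<rho>) $$ (x, y) = permutation_op n \<sigma> $$ (x, y)"
    using xy assms by (simp add: permutation_op_mult_entry del: index_mult_mat)
      (simp add: permutation_op_def from_bits_less bit_from_bits)
qed (simp_all add: permutation_op_def)

text \<open>A transposition is an involution, so its matrix is real, symmetric and its own inverse;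
  unitarity follows.\<close>

lemma elementary_swap:
  assumes "a < n" "b < n"
  shows "elementary_gate n (permutation_op n (Transposition.transpose a b))"
proof (rule elementary_gateI[where P = "{a, b}" and F = "\<lambda>f g. if g a = f b \<and> g b = f a then 1 else 0"])
  let ?\<tau> = "Transposition.transpose a b"
  have bound: "?\<tau> p < n" if "p < n" for p using that assms by (simp add: Transposition.transpose_def)
  show "unitary_op (2 ^ n) (permutation_op n ?\<tau>)"
  proof (rule unitary_opI)
    fix r c :: nat assume rc: "r < 2 ^ n" "c < 2 ^ n"
    have "(\<Sum>i<2 ^ n. cnj (permutation_op n ?\<tau> $$ (i, r)) * permutation_op n ?\<tau> $$ (i, c))
        = (\<Sum>i<2 ^ n. permutation_op n ?\<tau> $$ (r, i) * permutation_op n ?\<tau> $$ (i, c))"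
    proof (rule sum.cong)
      fix i :: nat assume i: "i \<in> {..<2 ^ n}"
      have "(\<forall>p<n. bit r p = bit i (?\<tau> p)) \<longleftrightarrow> (\<forall>p<n. bit i p = bit r (?\<tau> p))"
        using bound by (metis Transposition.transpose_involutory)
      then show "cnj (permutation_op n ?\<tau> $$ (i, r)) * permutation_op n ?\<tau> $$ (i, c)
          = permutation_op n ?\<tau> $$ (r, i) * permutation_op n ?\<tau> $$ (i, c)"
        using rc i by (simp add: permutation_op_def)
    qed simp
    also have "\<dots> = (permutation_op n ?\<tau> * permutation_op n ?\<tau>) $$ (r, c)"
      using rc by (simp add: mult_mat_entry[OF permutation_op_carrier permutation_op_carrier] del: index_mult_mat)
    also have "\<dots> = permutation_op n id $$ (r, c)"
      by (subst permutation_op_mult[where \<sigma> = id]) (use bound in auto)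
    also have "\<dots> = of_bool (r = c)"
      using rc by (auto simp: permutation_op_def nat_eq_iff_bits[OF rc])
    finally show "(\<Sum>i<2 ^ n. cnj (permutation_op n ?\<tau> $$ (i, r)) * permutation_op n ?\<tau> $$ (i, c))
        = of_bool (r = c)" .
  qed simp
  show "card {a, b} \<le> 2" by (simp add: card_insert_if)
  fix x y :: nat assume xy: "x < 2 ^ n" "y < 2 ^ n"
  have "(\<forall>p<n. bit y p = bit x (?\<tau> p)) \<longleftrightarrow>
      (\<forall>p\<in>{..<n} - {a, b}. bit x p = bit y p) \<and> bit y a = bit x b \<and> bit y b = bit x a"
    using assms by (auto simp: Transposition.transpose_def)
  then show "permutation_op n ?\<tau> $$ (x, y) = (if \<forall>p\<in>{..<n} - {a, b}. bit x p = bit y p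
      then if (a \<in> {a, b} \<and> bit y a) = (b \<in> {a, b} \<and> bit x b)
             \<and> (b \<in> {a, b} \<and> bit y b) = (a \<in> {a, b} \<and> bit x a) then 1 else 0 else 0)"
    using xy by (simp add: permutation_op_def)
qed (use assms in auto)

subsection \<open>Circuits for the Fourier transform\<close>

inductive gate_product :: "nat \<Rightarrow> nat \<Rightarrow> complex mat \<Rightarrow> bool" for n where
  one: "gate_product n 0 (1\<^sub>m (2 ^ n))"
| mult: "elementary_gate n G \<Longrightarrow> gate_product n k A \<Longrightarrow> gate_product n (Suc k) (G * A)"

lemma elementary_gate_carrier: "elementary_gate n G \<Longrightarrow> G \<in> carrier_mat (2 ^ n) (2 ^ n)"
  by (simp add: elementary_gate_def unitary_op_def)

lemma gate_product_carrier: "gate_product n k A \<Longrightarrow> A \<in> carrier_mat (2 ^ n) (2 ^ n)"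
  by (induction rule: gate_product.induct) (auto dest: elementary_gate_carrier)

lemma gate_product_mult:
  assumes "gate_product n k A" "gate_product n l B"
  shows "gate_product n (k + l) (A * B)"
  using assms(1)
proof induction
  case one
  then show ?case using assms(2) gate_product_carrier[OF assms(2)] by simp
next
  case (mult G k A)
  have "G * A * B = G * (A * B)"
    by (rule assoc_mult_mat[OF elementary_gate_carrier[OF mult(1)] gate_product_carrier[OF mult(2)]
          gate_product_carrier[OF assms(2)]])
  then show ?case using gate_product.mult[OF mult(1) mult.IH] by simp
qed

text \<open>The case \<open>k = 0\<close> is excluded because it would have the identity reached in
  arbitrarily short positive times, which the drift may prevent. The induction therefore really
  starts at a single gate.\<close>

lemma min_time_gate_product_le:
  assumes gates: "\<And>G. elementary_gate n G \<Longrightarrow> min_time (2 ^ n) m H M G \<le> ereal \<tau>"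
  shows "gate_product n k A \<Longrightarrow> k > 0 \<Longrightarrow> min_time (2 ^ n) m H M A \<le> ereal (real k * \<tau>)"
proof (induction rule: gate_product.induct)
  case (mult G k A)
  show ?case
  proof (cases "k = 0")
    case True
    with mult.hyps(2) have "A = 1\<^sub>m (2 ^ n)" by cases auto
    then show ?thesis
      using True gates[OF mult.hyps(1)] elementary_gate_carrier[OF mult.hyps(1)] by simp
  next
    case False
    then show ?thesis
      using min_time_mult_le[OF mult.IH gates[OF mult.hyps(1)]] by (simp add: algebra_simps)
  qed
qed simp

lemma diagonal_op_one: "diagonal_op n (\<lambda>_. 1) = 1\<^sub>m (2 ^ n)"
  by (rule eq_matI) (auto simp: diagonal_op_def)

lemma permutation_op_id:
  assumes "\<And>p. p < n \<Longrightarrow> \<pi> p = p"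
  shows "permutation_op n \<pi> = 1\<^sub>m (2 ^ n)"
  by (rule eq_matI) (use assms in \<open>auto simp: permutation_op_def nat_eq_iff_bits[of _ n]\<close>)

text \<open>Phases commute and their angles add: controlled by digit \<open>j < r\<close>, the angle
  is \<open>2 * pi * 2 ^ j / 2 ^ Suc q\<close>, and together these form the number made of the
  \<open>r\<close> lowest digits.\<close>

lemma gate_product_phases:
  assumes "q < n" "r \<le> q"
  shows "gate_product n r (diagonal_op n (\<lambda>x.
    if bit x q then cis (2 * pi * real (take_bit r x) / 2 ^ Suc q) else 1))"
  using assms(2)
proof (induction r)
  case 0
  then show ?case using gate_product.one by (simp add: diagonal_op_one cong: if_cong)
next
  case (Suc r)
  define \<theta> :: real where "\<theta> = 2 * pi * 2 ^ r / 2 ^ Suc q"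
  have "gate_product n (Suc r) (controlled_phase n q r \<theta> * diagonal_op n (\<lambda>x.
      if bit x q then cis (2 * pi * real (take_bit r x) / 2 ^ Suc q) else 1))"
    using Suc assms(1) by (intro gate_product.mult elementary_controlled_phase) auto
  also have "controlled_phase n q r \<theta> * diagonal_op n (\<lambda>x.
        if bit x q then cis (2 * pi * real (take_bit r x) / 2 ^ Suc q) else 1)
      = diagonal_op n (\<lambda>x. if bit x q then cis (2 * pi * real (take_bit (Suc r) x) / 2 ^ Suc q) else 1)"
  proof -
    have "(if bit x q \<and> bit x r then cis \<theta> else 1)
          * (if bit x q then cis (2 * pi * real (take_bit r x) / 2 ^ Suc q) else 1)
        = (if bit x q then cis (2 * pi * real (take_bit (Suc r) x) / 2 ^ Suc q) else 1)" for x :: nat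
    proof -
      have "real (take_bit (Suc r) x) = 2 ^ r * of_bool (bit x r) + real (take_bit r x)"
        by (simp add: take_bit_Suc_from_most)
      then show ?thesis
        by (auto simp: \<theta>_def cis_mult distrib_left add_divide_distrib simp del: power_Suc)
    qed
    then show ?thesis unfolding controlled_phase_def diagonal_op_mult by simp
  qed
  finally show ?case .
qed

text \<open>For \<open>q = 0\<close> this is the number whose \<open>n\<close> digits are those of
  \<open>x\<close> in reverse order; a larger \<open>q\<close> keeps only the positions already
  treated.\<close>

definition reversed_bits :: "nat \<Rightarrow> nat \<Rightarrow> nat \<Rightarrow> nat" where
  "reversed_bits n q x = (\<Sum>p\<in>{q..<n}. of_bool (bit x p) * 2 ^ (n - 1 - p))"

text \<open>
  \<open>qft_stage n q\<close> is the operator of the part of the circuit that has treated the positions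
  \<open>n - 1, \<dots>, q\<close>, with the output qubits still in reversed order.
\<close>

definition qft_stage :: "nat \<Rightarrow> nat \<Rightarrow> complex mat" where
  "qft_stage n q = mat (2 ^ n) (2 ^ n) (\<lambda>(x, k).
     if \<forall>p<q. bit x p = bit k p
     then cis (2 * pi * real k * real (reversed_bits n q x) / 2 ^ n) / complex_of_real (sqrt (2 ^ (n - q)))
     else 0)"

lemma qft_stage_carrier [simp]: "qft_stage n q \<in> carrier_mat (2 ^ n) (2 ^ n)"
  by (simp add: qft_stage_def)

text \<open>Digits of \<open>k\<close> above \<open>q\<close> give full turns and digit
  \<open>q\<close> gives a half turn, hence the sign. The lower digits can be read from the row
  index \<open>x\<close>, since the gates used so far have not altered them; this lets the phases
  act after the Hadamard gate.\<close>

lemma cis_binary_fraction: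
  fixes x k :: nat
  assumes "\<forall>p<q. bit x p = bit k p"
  shows "cis (2 * pi * real k / 2 ^ Suc q)
    = cis (2 * pi * real (take_bit q x) / 2 ^ Suc q) * (if bit k q then - 1 else 1)"
proof -
  have low: "take_bit q x = take_bit q k"
    by (rule bit_eqI) (use assms in \<open>auto simp: bit_take_bit_iff\<close>)
  define d t where "d = drop_bit (Suc q) k" and "t = take_bit q x"
  have "k = d * 2 ^ Suc q + 2 ^ q * of_bool (bit k q) + t"
    unfolding t_def d_def low using bits_ident[of "Suc q" k]
    by (simp add: take_bit_Suc_from_most push_bit_eq_mult)
  then have "real k = real (d * 2 ^ Suc q + 2 ^ q * of_bool (bit k q) + t)"
    by (rule arg_cong)
  also have "\<dots> = real d * 2 ^ Suc q + 2 ^ q * of_bool (bit k q) + real t"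
    by simp
  finally have "2 * pi * real k / 2 ^ Suc q = 2 * pi * real d + pi * of_bool (bit k q)
      + 2 * pi * real t / 2 ^ Suc q"
    by (simp add: field_simps)
  then have "cis (2 * pi * real k / 2 ^ Suc q) = cis (2 * pi * real d)
      * cis (pi * of_bool (bit k q)) * cis (2 * pi * real t / 2 ^ Suc q)"
    by (simp only: cis_mult)
  also have "cis (2 * pi * real d) = 1"
    by (rule cis_multiple_2pi) simp
  also have "cis (pi * of_bool (bit k q)) = (if bit k q then - 1 else 1)"
    by simp
  finally show ?thesis unfolding t_def by (simp only: mult_1_left mult.commute)
qed

text \<open>The stage at \<open>Suc q\<close> still requires row and column to agree at position
  \<open>q\<close>, so one of the two terms of the Hadamard product vanishes. The surviving term
  acquires the sign and \<open>1 / sqrt 2\<close>, and the diagonal factor supplies the rest of the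
  phase.\<close>

lemma qft_stage_step:
  assumes "q < n"
  shows "qft_stage n q = diagonal_op n (\<lambda>x.
      if bit x q then cis (2 * pi * real (take_bit q x) / 2 ^ Suc q) else 1)
    * (hadamard n q * qft_stage n (Suc q))" (is "_ = diagonal_op n ?D * _")
proof (rule eq_matI)
  fix x k
  assume "x < dim_row (diagonal_op n ?D * (hadamard n q * qft_stage n (Suc q)))"
    "k < dim_col (diagonal_op n ?D * (hadamard n q * qft_stage n (Suc q)))"
  then have xk: "x < 2 ^ n" "k < 2 ^ n" by (simp_all add: diagonal_op_def qft_stage_def)
  let ?R = "reversed_bits n (Suc q) x"
  let ?agree = "\<forall>p<q. bit x p = bit k p"
  let ?c = "cis (2 * pi * real k * real ?R / 2 ^ n) / complex_of_real (sqrt (2 ^ (n - Suc q)))"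
  have stage: "qft_stage n (Suc q) $$ (with_bit n q b x, k) = (if ?agree \<and> b = bit k q then ?c else 0)" for b
  proof -
    have "reversed_bits n (Suc q) (with_bit n q b' x) = ?R" for b'
      by (auto simp: reversed_bits_def bit_with_bit intro!: sum.cong)
    moreover have "(\<forall>p<Suc q. bit (with_bit n q b x) p = bit k p) \<longleftrightarrow> ?agree \<and> b = bit k q"
      using assms by (auto simp: bit_with_bit less_Suc_eq)
    ultimately show ?thesis using xk by (simp add: qft_stage_def with_bit_less)
  qed
  have "(diagonal_op n ?D * (hadamard n q * qft_stage n (Suc q))) $$ (x, k)
      = ?D x * (hadamard n q * qft_stage n (Suc q)) $$ (x, k)"
    by (rule diagonal_op_mult_entry) (use xk in \<open>auto intro: mult_carrier_mat[OF hadamard_carrier]\<close>)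
  also have "(hadamard n q * qft_stage n (Suc q)) $$ (x, k)
      = (if ?agree then (if bit x q \<and> bit k q then - 1 else 1) * ?c / complex_of_real (sqrt 2) else 0)"
    unfolding hadamard_mult_entry[OF qft_stage_carrier assms xk] stage by auto
  also have "?D x * \<dots> = qft_stage n q $$ (x, k)"
  proof (cases ?agree)
    case True
    \<comment> \<open>Digit \<open>q\<close> has weight \<open>2 ^ (n - Suc q)\<close> in the
      reversed number; dividing by \<open>2 ^ n\<close> leaves the fraction
      \<open>k / 2 ^ Suc q\<close>.\<close>
    have pow: "(2::real) ^ n = 2 ^ Suc q * 2 ^ (n - Suc q)"
      using power_add[of "2::real" "Suc q" "n - Suc q"] assms by simp
    have "{q..<n} = insert q {Suc q..<n}" using assms by auto
    then have "real (reversed_bits n q x) = of_bool (bit x q) * 2 ^ (n - Suc q) + real ?R"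
      by (simp add: reversed_bits_def)
    then have "2 * pi * real k * real (reversed_bits n q x) / 2 ^ n
        = of_bool (bit x q) * (2 * pi * real k / 2 ^ Suc q) + 2 * pi * real k * real ?R / 2 ^ n"
      by (simp add: distrib_left add_divide_distrib) (simp add: pow field_simps)
    then have "cis (2 * pi * real k * real (reversed_bits n q x) / 2 ^ n)
        = (if bit x q then cis (2 * pi * real k / 2 ^ Suc q) else 1) * cis (2 * pi * real k * real ?R / 2 ^ n)"
      by (simp add: cis_mult)
    also have "(if bit x q then cis (2 * pi * real k / 2 ^ Suc q) else 1)
        = ?D x * (if bit x q \<and> bit k q then - 1 else 1)"
      using cis_binary_fraction[OF True] by simp
    finally have phase: "cis (2 * pi * real k * real (reversed_bits n q x) / 2 ^ n)
        = ?D x * (if bit x q \<and> bit k q then - 1 else 1) * cis (2 * pi * real k * real ?R / 2 ^ n)" .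
    have "n - q = Suc (n - Suc q)" using assms by simp
    then have "sqrt (2 ^ (n - q)) = sqrt (2 ^ (n - Suc q)) * sqrt 2"
      by (simp add: real_sqrt_mult mult.commute)
    then show ?thesis using True xk by (simp add: qft_stage_def phase)
  qed (use xk in \<open>auto simp: qft_stage_def\<close>)
  finally show "qft_stage n q $$ (x, k)
      = (diagonal_op n ?D * (hadamard n q * qft_stage n (Suc q))) $$ (x, k)" by simp
qed (simp_all add: diagonal_op_def qft_stage_def)

text \<open>Downward induction from \<open>q = n\<close>, where all digits must agree and the phase
  is empty, so the stage is the identity.\<close>

lemma gate_product_qft_stage: "q \<le> n \<Longrightarrow> gate_product n (\<Sum>i\<in>{q..<n}. Suc i) (qft_stage n q)"
proof (induction q rule: inc_induct)
  case base
  have "qft_stage n n = 1\<^sub>m (2 ^ n)"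
    by (rule eq_matI) (auto simp: qft_stage_def reversed_bits_def nat_eq_iff_bits[of _ n])
  then show ?case using gate_product.one by simp
next
  case (step q)
  have "{q..<n} = insert q {Suc q..<n}" using step by auto
  then have "(\<Sum>i\<in>{q..<n}. Suc i) = q + Suc (\<Sum>i\<in>{Suc q..<n}. Suc i)" by simp
  then show ?case
    unfolding qft_stage_step[OF step(2)]
    using gate_product_mult[OF gate_product_phases[OF step(2) order_refl]
        gate_product.mult[OF elementary_hadamard[OF step(2)] step.IH]] by (simp only:)
qed

text \<open>Pairs are exchanged from the outside inwards: step \<open>r\<close> swaps
  \<open>r\<close> with its mirror image, both still fixed by the earlier swaps. The condition
  \<open>2 * r \<le> n\<close> keeps the pairs disjoint.\<close>

lemma gate_product_reversal:
  "2 * r \<le> n \<Longrightarrow> gate_product n r (permutation_op n (\<lambda>p. if p < r \<or> n - r \<le> p then n - 1 - p else p))"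
proof (induction r)
  case 0
  have "permutation_op n (\<lambda>p. if p < 0 \<or> n - 0 \<le> p then n - 1 - p else p) = 1\<^sub>m (2 ^ n)"
    by (rule permutation_op_id) auto
  then show ?case using gate_product.one by simp
next
  case (Suc r)
  let ?\<tau> = "Transposition.transpose r (n - 1 - r)"
  let ?\<pi> = "\<lambda>r p. if p < r \<or> n - r \<le> p then n - 1 - p else p"
  have "permutation_op n ?\<tau> * permutation_op n (?\<pi> r) = permutation_op n (?\<pi> (Suc r))"
    by (rule permutation_op_mult) (use Suc.prems in \<open>auto simp: Transposition.transpose_def\<close>)
  moreover have "gate_product n (Suc r) (permutation_op n ?\<tau> * permutation_op n (?\<pi> r))"
    using Suc by (intro gate_product.mult elementary_swap) auto
  ultimately show ?case by simp
qed

lemma qft_eq: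
  "qft n = permutation_op n (\<lambda>p. if p < n div 2 \<or> n - n div 2 \<le> p then n - 1 - p else p) * qft_stage n 0"
    (is "_ = permutation_op n ?\<pi> * _")
proof (rule eq_matI)
  fix l k
  assume "l < dim_row (permutation_op n ?\<pi> * qft_stage n 0)" "k < dim_col (permutation_op n ?\<pi> * qft_stage n 0)"
  then have lk: "l < 2 ^ n" "k < 2 ^ n" by (simp_all add: permutation_op_def qft_stage_def)
  define y where "y = from_bits n (\<lambda>p. bit l (?\<pi> p))"
  have "y < 2 ^ n" by (simp add: y_def from_bits_less)
  have bit_y: "bit y p \<longleftrightarrow> bit l (n - Suc p)" if "p < n" for p
  proof -
    \<comment> \<open>A position left alone by the swaps is the middle one of an odd
      \<open>n\<close>, which is its own mirror image.\<close>
    have "?\<pi> p = n - Suc p" using that by auto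
    then show ?thesis unfolding y_def bit_from_bits using that by (simp only: simp_thms)
  qed
  have "reversed_bits n 0 y = (\<Sum>p<n. of_bool (bit l (n - Suc p)) * 2 ^ (n - Suc p))"
    unfolding reversed_bits_def by (rule sum.cong) (auto simp: bit_y)
  also have "\<dots> = (\<Sum>p<n. of_bool (bit l p) * 2 ^ p)"
    by (rule sum.nat_diff_reindex)
  also have "\<dots> = take_bit n l"
    by (simp add: take_bit_sum push_bit_eq_mult atLeast0LessThan)
  also have "\<dots> = l" using lk by (simp add: take_bit_nat_eq_self)
  finally have rev: "reversed_bits n 0 y = l" .
  have "(permutation_op n ?\<pi> * qft_stage n 0) $$ (l, k) = qft_stage n 0 $$ (y, k)"
    unfolding y_def by (rule permutation_op_mult_entry) (use lk in auto)
  also have "\<dots> = cis (2 * pi * real k * real l / 2 ^ n) / complex_of_real (sqrt (2 ^ n))"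
    using lk \<open>y < 2 ^ n\<close> by (simp add: qft_stage_def rev)
  also have "\<dots> = qft n $$ (l, k)"
    using lk by (simp add: qft_def cis_conv_exp mult_ac)
  finally show "qft n $$ (l, k) = (permutation_op n ?\<pi> * qft_stage n 0) $$ (l, k)" by simp
qed (simp_all add: qft_def permutation_op_def qft_stage_def)

lemma gate_product_qft: "gate_product n (n div 2 + (\<Sum>i<n. Suc i)) (qft n)"
proof -
  have stage: "gate_product n (\<Sum>i<n. Suc i) (qft_stage n 0)"
    using gate_product_qft_stage[of 0 n] by (simp only: atLeast0LessThan le0)
  show ?thesis
    unfolding qft_eq by (rule gate_product_mult[OF gate_product_reversal stage]) simp
qed

theorem theorem3p2p3:
  fixes m :: "nat \<Rightarrow> nat"
    and H :: "nat \<Rightarrow> nat \<Rightarrow> complex mat"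
    and M \<tau> :: real
  assumes "M > 0"
    and "\<And>n j. n \<ge> 1 \<Longrightarrow> j \<le> m n \<Longrightarrow> self_adjoint_op (2 ^ n) (H n j)"
    and "\<And>n. n \<ge> 1 \<Longrightarrow> operator_controllable (2 ^ n) (m n) (H n) M"
    and "\<tau> > 0"
    and "\<And>n G. n \<ge> 1 \<Longrightarrow> elementary_gate n G \<Longrightarrow>
           min_time (2 ^ n) (m n) (H n) M G \<le> ereal \<tau>"
  shows "quantum_advantage m H M qft
    \<and> (\<forall>n\<ge>1.
         min_time (2 ^ n) (m n) (H n) M (qft n)
           \<le> ereal (\<tau> * (real n * (real n + 1) / 2 + real_of_int \<lfloor>real n / 2\<rfloor>))
         \<and> \<tau> * (real n * (real n + 1) / 2 + real_of_int \<lfloor>real n / 2\<rfloor>) \<le> \<tau> * (real n)\<^sup>2)"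
proof -
  let ?c = "\<lambda>n. real n * (real n + 1) / 2 + real_of_int \<lfloor>real n / 2\<rfloor>"
  have bound: "min_time (2 ^ n) (m n) (H n) M (qft n) \<le> ereal (\<tau> * ?c n)" if "n \<ge> 1" for n
  proof -
    have "real (\<Sum>i<n. Suc i) = real n * (real n + 1) / 2" for n
      by (induction n) (auto simp: field_simps)
    moreover have "\<lfloor>real n / 2\<rfloor> = int (n div 2)"
      using floor_divide_of_nat_eq[of n 2] by simp
    ultimately have "real (n div 2 + (\<Sum>i<n. Suc i)) = ?c n" by simp
    moreover have "0 < n div 2 + (\<Sum>i<n. Suc i)"
      using that by (cases n) auto
    ultimately show ?thesis
      using min_time_gate_product_le[OF assms(5)[OF that] gate_product_qft]
      by (simp only: mult.commute)
  qed
  have square: "?c n \<le> (real n)\<^sup>2" if "n \<ge> 1" for n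
  \<comment> \<open>For \<open>n \<ge> 2\<close> the count is at most \<open>n ^ 2 / 2 + n\<close>,
    and \<open>2 * n \<le> n ^ 2\<close> finishes. For \<open>n = 1\<close> this fails, but rounding
    down removes the half and the count is \<open>1\<close>.\<close>
  proof (cases "n = 1")
    case False
    with that have "2 * real n \<le> real n * real n" by (intro mult_right_mono) auto
    moreover have "real_of_int \<lfloor>real n / 2\<rfloor> \<le> real n / 2" by (rule of_int_floor_le)
    ultimately show ?thesis by (simp add: power2_eq_square field_simps)
  qed simp
  have square_bound: "\<tau> * ?c n \<le> \<tau> * (real n)\<^sup>2" if "n \<ge> 1" for n
    using square[OF that] assms(4) by simp
  have "quantum_advantage m H M qft"
    unfolding quantum_advantage_def
  proof (intro conjI allI impI)
    fix n :: nat assume "1 \<le> n"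
    \<comment> \<open>Adding \<open>1\<close> makes the bound strict, the form from which
      \<open>min_time_less_iff\<close> extracts a control.\<close>
    from le_less_trans[OF bound[OF this], of "ereal (\<tau> * ?c n + 1)"]
    show "\<exists>T>0. \<exists>u. steers (2 ^ n) (m n) (H n) M T u (qft n)"
      unfolding min_time_less_iff by auto
  next
    show "\<exists>C p. \<forall>n\<ge>1. min_time (2 ^ n) (m n) (H n) M (qft n) \<le> ereal (C * real n ^ p)"
    proof (intro exI allI impI)
      fix n :: nat assume n: "1 \<le> n"
      show "min_time (2 ^ n) (m n) (H n) M (qft n) \<le> ereal (\<tau> * real n ^ 2)"
        using bound[OF n] square_bound[OF n] order_trans by fastforce
    qed
  qed
  with bound square_bound show ?thesis by blast
qed

end
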